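(* (1) Let $a,b$ be positive coprime integers and let $\{m\}_n$ be the Euclidean design of $a$ generated by $b$. Then $a=[2^n:m]$ and $b=[2^n:2^n-m]$. In particular, if $(a,b)=(1,1)$ then $(m,n)=(1,1)$. (2) Let $m,n$ be positive integers with $m$ odd, $1\le m\le 2^n-1$ and $(m,n)\ne(1,1)$, and write the binary word $\{m\}_n=1^{k_0}0^{k_1}\cdots 0^{k_{l-2}}1^{k_{l-1}}$ with $l$ odd, $k_0\ge 0$ and $k_i\ge 1$ for $i=1,\dots,l-1$. (i) If $m\equiv 3 \pmod 4$ (i.e. $k_{l-1}\ge 2$), put $t=l$ and $r_i=k_i$ for $i=0,\dots,t-1$. Then the realizing pair $(a,b)$ of $r_0,\dots,r_{t-1}$ exists, and $\{m\}_n$ is the Euclidean design of $a$ generated by $b$. (ii) If $m\equiv 1\pmod 4$ (i.e. $k_{l-1}=1$), put $t=l-1$, $r_i=k_i$ for $i=0,\dots,t-2$, and $r_{t-1}=k_{l-2}+1$. Then the realizing pair $(a,b)$ of $r_0,\dots,r_{t-1}$ exists, and $\{m\}_n$ is the Euclidean design of $a$ generated by $b$.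
   Context: Stern's diatomic integers: for integers $n\ge0$, $0\le m\le 2^n$, define $[2^0:0]=0$, $[2^0:1]=1$, $[2^{n+1}:2m]=[2^n:m]$ ($0\le m\le 2^n$), $[2^{n+1}:2m+1]=[2^n:m]+[2^n:m+1]$ ($0\le m\le 2^n-1$). Designs: for $0\le m\le 2^n-1$, $\{m\}_n$ denotes the binary word $d_1d_2\cdots d_n$ of length $n$ (leading zeros allowed) with $\sum_{i=1}^n 2^{n-i}d_i=m$. We write $x^k$ for $k$ consecutive copies of the letter $x$. Partial quotients: for positive coprime integers $a,b$, run the Euclidean algorithm $c_{i-2}=c_{i-1}r_i+c_i$ ($i=0,1,\dots,t-1$) with $c_{-2}=a$, $c_{-1}=b$, integers $0\le c_i<c_{i-1}$, terminating with $c_{t-2}=1$, $c_{t-1}=0$ ($t\ge1$); then $r_0\ge0$, $r_i\ge 1$ ($i\ge1$), and $r_0,\dots,r_{t-1}$ are called the partial quotients of $a$ generated by $b$. For any sequence of integers $r_0\ge0$, $r_1,\dots,r_{t-2}\ge1$, $r_{t-1}\ge2$ there is a unique pair $(a,b)$ of positive coprime integers whose partial quotients are $r_0,\dots,r_{t-1}$; it is called the realizing pair of the sequence. Euclidean design: for positive coprime $a,b$ with partial quotients $r_0,\dots,r_{t-1}$ and $n=\sum r_i$, the Euclidean design of $a$ generated by $b$ is the word $1$ (i.e. $\{1\}_1$) if $(a,b)=(1,1)$; the word $1^{r_0}0^{r_1}1^{r_2}\cdots 0^{r_{t-2}}1^{r_{t-1}}$ if $(a,b)\neq(1,1)$ and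 $t$ is odd; and the word $1^{r_0}0^{r_1}\cdots 1^{r_{t-2}}0^{r_{t-1}-1}1$ if $(a,b)\neq(1,1)$ and $t$ is even. Writing it as $\{m\}_n$, $m$ is called the design number. *)

theory Defs
  imports Main
begin

text \<open>\<open>stern n m\<close> is Stern's integer \<open>[2^n : m]\<close>; only the values with \<open>m \<le> 2 ^ n\<close> are meaningful.\<close>

fun stern :: "nat \<Rightarrow> nat \<Rightarrow> nat" where
  "stern 0 m = (if m = 0 then 0 else 1)"
| "stern (Suc n) m =
     (if even m then stern n (m div 2) else stern n (m div 2) + stern n (m div 2 + 1))"

text \<open>\<open>design m n\<close> is the word \<open>{m}\<^sub>n\<close>, for \<open>m < 2 ^ n\<close>; the letter \<open>d\<^sub>i\<close> is \<open>w ! (i - 1)\<close>.\<close>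

definition binary_word_of :: "nat \<Rightarrow> nat \<Rightarrow> nat list \<Rightarrow> bool" where
  "binary_word_of m n w \<longleftrightarrow>
     length w = n \<and> set w \<subseteq> {0, 1} \<and> (\<Sum>i = 1..n. 2 ^ (n - i) * w ! (i - 1)) = m"

definition design :: "nat \<Rightarrow> nat \<Rightarrow> nat list" where
  "design m n = (THE w. binary_word_of m n w)"

lemma binary_word_of_snoc:
  "binary_word_of m (Suc n) (w @ [d]) \<longleftrightarrow>
     d \<in> {0, 1} \<and> (\<exists>m'. binary_word_of m' n w \<and> m = 2 * m' + d)"
proof -
  have "(\<Sum>i = 1..Suc n. 2 ^ (Suc n - i) * (w @ [d]) ! (i - 1))
      = 2 * (\<Sum>i = 1..n. 2 ^ (n - i) * w ! (i - 1)) + d" if "length w = n"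
  proof -
    have "(\<Sum>i = 1..n. 2 ^ (Suc n - i) * (w @ [d]) ! (i - 1))
        = (\<Sum>i = 1..n. 2 * (2 ^ (n - i) * w ! (i - 1)))"
      using that by (intro sum.cong) (auto simp: nth_append Suc_diff_le)
    then show ?thesis
      using that by (simp add: sum_distrib_left nth_append)
  qed
  then show ?thesis
    by (auto simp: binary_word_of_def)
qed

lemma binary_word_of_ex1:
  assumes "m < 2 ^ n"
  shows "\<exists>!w. binary_word_of m n w"
  using assms
proof (induction n arbitrary: m)
  case 0
  then show ?case by (auto simp: binary_word_of_def)
next
  case (Suc n)
  then have "m div 2 < 2 ^ n" by auto
  with Suc.IH obtain w where w: "binary_word_of (m div 2) n w"
    and uniq: "\<And>v. binary_word_of (m div 2) n v \<Longrightarrow> v = w" by blast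
  show ?case
  proof (rule ex1I)
    show "binary_word_of m (Suc n) (w @ [m mod 2])"
      using w by (auto simp: binary_word_of_snoc intro!: exI[of _ "m div 2"])
  next
    fix v assume v: "binary_word_of m (Suc n) v"
    then have "v \<noteq> []" by (auto simp: binary_word_of_def)
    then obtain u d where ud: "v = u @ [d]" by (metis rev_exhaust)
    with v obtain m' where "d \<in> {0, 1}" "binary_word_of m' n u" "m = 2 * m' + d"
      by (auto simp: binary_word_of_snoc)
    then have "m div 2 = m'" "m mod 2 = d" by auto
    with \<open>binary_word_of m' n u\<close> uniq ud show "v = w @ [m mod 2]" by auto
  qed
qed

lemma binary_word_of_design: "m < 2 ^ n \<Longrightarrow> binary_word_of m n (design m n)"
  unfolding design_def by (rule theI') (rule binary_word_of_ex1)

text \<open>The word \<open>1^{k\<^sub>0} 0^{k\<^sub>1} 1^{k\<^sub>2} \<dots>\<close> for \<open>ks = [k\<^sub>0, k\<^sub>1, k\<^sub>2, \<dots>]\<close>.\<close>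

definition block_word :: "nat list \<Rightarrow> nat list" where
  "block_word ks =
     concat (map (\<lambda>i. replicate (ks ! i) (if even i then 1 else 0)) [0..<length ks])"

text \<open>The Euclidean algorithm with \<open>c\<^sub>-\<^sub>2 = a\<close>, \<open>c\<^sub>-\<^sub>1 = b\<close>; it returns \<open>[r\<^sub>0, \<dots>, r\<^bsub>t-1\<^esub>]\<close>.\<close>

fun partial_quotients :: "nat \<Rightarrow> nat \<Rightarrow> nat list" where
  "partial_quotients a b =
     (if b = 0 then [] else (a div b) # partial_quotients b (a mod b))"

declare partial_quotients.simps [simp del]

definition admissible :: "nat list \<Rightarrow> bool" where
  "admissible rs \<longleftrightarrow>
     rs \<noteq> [] \<and> (\<forall>i. 1 \<le> i \<and> i + 1 < length rs \<longrightarrow> 1 \<le> rs ! i) \<and> 2 \<le> last rs"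

definition realizing_pair :: "nat list \<Rightarrow> nat \<times> nat \<Rightarrow> bool" where
  "realizing_pair rs p \<longleftrightarrow>
     admissible rs \<and> 0 < fst p \<and> 0 < snd p \<and> coprime (fst p) (snd p) \<and>
     partial_quotients (fst p) (snd p) = rs"

definition euclidean_design :: "nat \<Rightarrow> nat \<Rightarrow> nat list" where
  "euclidean_design a b =
     (let rs = partial_quotients a b in
      if (a, b) = (1, 1) then [1]
      else if odd (length rs) then block_word rs
      else block_word (butlast rs @ [last rs - 1]) @ [1])"

text \<open>\<open>w = 1^{k\<^sub>0} 0^{k\<^sub>1} \<dots> 1^{k\<^bsub>l-1\<^esub>}\<close> with \<open>l\<close> odd, where only \<open>k\<^sub>0\<close> may vanish.\<close>

definition block_lengths :: "nat list \<Rightarrow> nat list \<Rightarrow> bool" where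
  "block_lengths w ks \<longleftrightarrow>
     odd (length ks) \<and> (\<forall>i. 1 \<le> i \<and> i < length ks \<longrightarrow> 1 \<le> ks ! i) \<and> w = block_word ks"

end

theory Submission
  imports Defs
begin

text \<open>
  Let the letter \<open>1\<close> act on pairs by \<open>(a, b) \<mapsto> (a + b, b)\<close> and the letter \<open>0\<close> by
  \<open>(a, b) \<mapsto> (a, a + b)\<close>. Read from right to left, starting at \<open>(0, 1)\<close>, the word \<open>{m}\<^sub>n\<close> yields
  \<open>([2^n : m], [2^n : 2^n - m])\<close>. On the other hand a block \<open>1^r\<close> or \<open>0^r\<close> undoes one division with
  quotient \<open>r\<close>, up to exchanging the two entries, so reading a Euclidean design from right to left runs
  the Euclidean algorithm backwards. Both shapes of the Euclidean design agree with the block word of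
  the partial quotients, the last one lowered by one, followed by a final letter \<open>1\<close>; this reduces the
  second part to comparing block words.
\<close>

subsection \<open>Stern's integers and the action of binary words\<close>

fun calkin_wilf_child :: "nat \<Rightarrow> nat \<times> nat \<Rightarrow> nat \<times> nat" where
  "calkin_wilf_child d (a, b) = (if d = 0 then (a, a + b) else (a + b, b))"

abbreviation word_action :: "nat list \<Rightarrow> nat \<times> nat \<Rightarrow> nat \<times> nat" where
  "word_action \<equiv> foldr calkin_wilf_child"

lemma word_action_complement:
  "word_action (map (\<lambda>d. 1 - d) w) p = prod.swap (word_action w (prod.swap p))"
proof (induction w)
  case Nil
  show ?case by simp
next
  case (Cons d w)
  then show ?case
    by (cases "word_action w (prod.swap p)") auto
qed

lemma binary_word_of_less: "binary_word_of m n w \<Longrightarrow> m < 2 ^ n"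
proof (induction w arbitrary: m n rule: rev_induct)
  case Nil
  then show ?case by (auto simp: binary_word_of_def)
next
  case (snoc d w)
  then obtain k where "n = Suc k" by (auto simp: binary_word_of_def)
  with snoc show ?case by (fastforce simp: binary_word_of_snoc)
qed

lemma binary_word_of_design_le: "m \<le> 2 ^ n - 1 \<Longrightarrow> binary_word_of m n (design m n)"
  by (rule binary_word_of_design) (simp add: le_diff_conv2 Suc_le_eq)

lemma binary_word_of_singleton_1: "binary_word_of m n [1] \<longleftrightarrow> m = 1 \<and> n = 1"
  by (auto simp: binary_word_of_def)

text \<open>Stern's recursion appends letters on the right, where a new letter changes the starting pair;
  hence the general starting pair \<open>(x, y)\<close>.\<close>

lemma word_action_eq_stern:
  assumes "binary_word_of m n w"
  shows "word_action w (x, y) =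
    (x * stern n (m + 1) + y * stern n m,
     x * stern n (2 ^ n - (m + 1)) + y * stern n (2 ^ n - m))"
  using assms
proof (induction w arbitrary: m n x y rule: rev_induct)
  case Nil
  then show ?case by (auto simp: binary_word_of_def)
next
  case (snoc d w)
  then obtain k where n: "n = Suc k" by (auto simp: binary_word_of_def)
  with snoc.prems obtain m' where d: "d \<in> {0, 1}" and w: "binary_word_of m' k w"
    and m: "m = 2 * m' + d"
    by (auto simp: binary_word_of_snoc)
  obtain l where l: "2 ^ k = m' + 1 + l"
    using binary_word_of_less[OF w] by (metis Suc_eq_plus1 Suc_leI le_iff_add)
  have IH: "word_action w (x', y') =
      (x' * stern k (m' + 1) + y' * stern k m', x' * stern k l + y' * stern k (l + 1))" for x' y'
    using snoc.IH[OF w, of x' y'] l by simp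
  show ?case
  proof (cases "d = 0")
    case True
    then have "2 ^ n - (m + 1) = 2 * l + 1" "2 ^ n - m = 2 * (l + 1)"
      using n m l by simp_all
    with True n m IH show ?thesis by (simp add: algebra_simps)
  next
    case False
    then have "2 ^ n - (m + 1) = 2 * l" "2 ^ n - m = 2 * l + 1" "m + 1 = 2 * (m' + 1)"
      using n m l d by simp_all
    with False n m d IH show ?thesis by (simp add: algebra_simps)
  qed
qed

subsection \<open>Block words\<close>

lemma block_word_Nil [simp]: "block_word [] = []"
  by (simp add: block_word_def)

lemma block_word_snoc:
  "block_word (ks @ [k]) = block_word ks @ replicate k (if even (length ks) then 1 else 0)"
  by (auto simp: block_word_def nth_append intro!: arg_cong[of _ _ concat])

lemma block_word_snoc_Suc:
  "block_word (ks @ [Suc k]) = block_word (ks @ [k]) @ [if even (length ks) then 1 else 0]"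
  by (simp add: block_word_snoc replicate_append_same)

lemma block_word_Cons:
  "block_word (k # ks) = replicate k 1 @ map (\<lambda>d. 1 - d) (block_word ks)"
proof (induction ks rule: rev_induct)
  case Nil
  show ?case using block_word_snoc[of "[]" k] by simp
next
  case (snoc l ks)
  then show ?case
    using block_word_snoc[of "k # ks" l] by (simp add: block_word_snoc)
qed

lemma block_word_exists:
  assumes "set w \<subseteq> {0, 1}"
  shows "\<exists>ks k. w = block_word (ks @ [k]) \<and> 0 \<notin> set (tl (ks @ [k]))"
  using assms
proof (induction w rule: rev_induct)
  case Nil
  show ?case by (intro exI[of _ "[]"] exI[of _ 0]) (simp add: block_word_Cons)
next
  case (snoc d w)
  then obtain ks k where w: "w = block_word (ks @ [k])" and pos: "0 \<notin> set (tl (ks @ [k]))"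
    by auto
  show ?case
  proof (cases "d = (if even (length ks) then 1 else 0)")
    case True
    with w have "w @ [d] = block_word (ks @ [Suc k])"
      by (simp add: block_word_snoc_Suc)
    moreover have "0 \<notin> set (tl (ks @ [Suc k]))"
      using pos by (cases ks) auto
    ultimately show ?thesis by blast
  next
    case False
    with w snoc.prems have "w @ [d] = block_word ((ks @ [k]) @ [1])"
      unfolding block_word_snoc[of "ks @ [k]" 1] by auto
    moreover have "0 \<notin> set (tl ((ks @ [k]) @ [1]))"
      using pos by (cases ks) auto
    ultimately show ?thesis by blast
  qed
qed

lemma zero_notin_set_tl_iff:
  fixes ks :: "nat list"
  shows "0 \<notin> set (tl ks) \<longleftrightarrow> (\<forall>i. 1 \<le> i \<and> i < length ks \<longrightarrow> 1 \<le> ks ! i)"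
proof (cases ks)
  case (Cons k ls)
  have "(\<forall>i. 1 \<le> i \<and> i < length ks \<longrightarrow> 1 \<le> ks ! i)
      \<longleftrightarrow> (\<forall>i<Suc (length ls). 1 \<le> i \<longrightarrow> 1 \<le> (k # ls) ! i)"
    by (auto simp: Cons)
  also have "\<dots> \<longleftrightarrow> 0 \<notin> set (tl ks)"
    by (auto simp: Cons All_less_Suc2 in_set_conv_nth Suc_le_eq)
  finally show ?thesis by simp
qed simp

lemma block_lengths_iff:
  "block_lengths w ks \<longleftrightarrow> odd (length ks) \<and> 0 \<notin> set (tl ks) \<and> w = block_word ks"
  by (simp add: block_lengths_def zero_notin_set_tl_iff)

lemma block_lengths_last_pos:
  assumes "block_lengths w ks" "w \<noteq> []"
  shows "0 < last ks"
proof (cases ks)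
  case Nil
  with assms show ?thesis by (simp add: block_lengths_iff)
next
  case (Cons k ls)
  with assms show ?thesis
    by (cases "ls = []")
      (auto simp: block_lengths_iff block_word_Cons intro!: gr0I dest: last_in_set)
qed

lemma block_lengths_exists:
  assumes "set w \<subseteq> {0, 1}" "w \<noteq> []" "last w = 1"
  shows "\<exists>ks. block_lengths w ks"
proof -
  obtain ks k where w: "w = block_word (ks @ [k])" and pos: "0 \<notin> set (tl (ks @ [k]))"
    using block_word_exists[OF assms(1)] by blast
  have "k \<noteq> 0"
    using pos w assms(2) by (cases ks) (auto simp: block_word_Cons)
  then have "even (length ks)"
    using assms(3) unfolding w block_word_snoc by (simp split: if_splits)
  with w pos show ?thesis
    by (intro exI[of _ "ks @ [k]"]) (simp add: block_lengths_iff)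
qed

subsection \<open>Recovering a coprime pair from its partial quotients\<close>

fun undo_division :: "nat \<Rightarrow> nat \<times> nat \<Rightarrow> nat \<times> nat" where
  "undo_division q (b, r) = (q * b + r, b)"

definition continuant_pair :: "nat list \<Rightarrow> nat \<times> nat" where
  "continuant_pair rs = foldr undo_division rs (1, 0)"

lemma continuant_pair_Nil [simp]: "continuant_pair [] = (1, 0)"
  and continuant_pair_Cons [simp]:
    "continuant_pair (r # rs) = undo_division r (continuant_pair rs)"
  by (simp_all add: continuant_pair_def)

lemma partial_quotients_0 [simp]: "partial_quotients a 0 = []"
  by (subst partial_quotients.simps) simp

lemma partial_quotients_rec:
  "0 < b \<Longrightarrow> partial_quotients a b = (a div b) # partial_quotients b (a mod b)"
  by (subst partial_quotients.simps) simp

lemma partial_quotients_eq_Nil_iff [simp]: "partial_quotients a b = [] \<longleftrightarrow> b = 0"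
  by (subst partial_quotients.simps) simp

lemma last_partial_quotients_pos:
  assumes "0 < a" "0 < b"
  shows "0 < last (partial_quotients a b)"
  using assms
proof (induction a b rule: partial_quotients.induct)
  case (1 a b)
  show ?case
  proof (cases "b dvd a")
    case True
    with "1.prems" show ?thesis
      by (simp add: partial_quotients_rec[of b a] div_greater_zero_iff dvd_imp_le)
  next
    case False
    then have "0 < a mod b" by (simp add: mod_greater_zero_iff_not_dvd)
    with 1 show ?thesis by (simp add: partial_quotients_rec[of b a])
  qed
qed

lemma foldr_undo_division_partial_quotients:
  "foldr undo_division (partial_quotients a b) (gcd a b, 0) = (a, b)"
proof (induction a b rule: partial_quotients.induct)
  case (1 a b)
  then show ?case
    by (cases "b = 0") (simp_all add: partial_quotients_rec[of b a] gcd_red_nat[of a b])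
qed

lemma continuant_pair_partial_quotients:
  "coprime a b \<Longrightarrow> continuant_pair (partial_quotients a b) = (a, b)"
  using foldr_undo_division_partial_quotients[of a b] by (simp add: continuant_pair_def)

lemma coprime_continuant_pair: "continuant_pair rs = (a, b) \<Longrightarrow> coprime a b"
proof (induction rs arbitrary: a b)
  case Nil
  then show ?case by simp
next
  case (Cons r rs)
  obtain b' c where "continuant_pair rs = (b', c)" by fastforce
  with Cons show ?case
    by (auto simp: coprime_iff_gcd_eq_1 gcd.commute[of "_ + _"] gcd_add_mult)
qed

lemma continuant_pair_gt:
  assumes "rs \<noteq> []" "0 \<notin> set rs" "2 \<le> last rs" "continuant_pair rs = (a, b)"
  shows "0 < b" "b < a"
proof -
  have "0 < b \<and> b < a"
    using assms
  proof (induction rs arbitrary: a b rule: list_nonempty_induct)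
    case (single r)
    then show ?case by auto
  next
    case (cons r rs)
    obtain b' c where p: "continuant_pair rs = (b', c)" by fastforce
    with cons have "0 < c" "c < b'" by auto
    moreover from this have "b' < r * b' + c" using cons.prems(1) by (cases r) auto
    ultimately show ?case using cons.prems p by auto
  qed
  then show "0 < b" "b < a" by simp_all
qed

lemma partial_quotients_continuant_pair:
  assumes "rs \<noteq> []" "0 \<notin> set (tl rs)" "2 \<le> last rs" "continuant_pair rs = (a, b)"
  shows "0 < a" "0 < b" "partial_quotients a b = rs"
proof -
  have "0 < a \<and> 0 < b \<and> partial_quotients a b = rs"
    using assms
  proof (induction rs arbitrary: a b rule: list_nonempty_induct)
    case (single r)
    then show ?case by (auto simp: partial_quotients_rec)
  next
    case (cons r rs)
    obtain b' c where p: "continuant_pair rs = (b', c)" by fastforce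
    with cons have c: "0 < c" "c < b'" using continuant_pair_gt[OF _ _ _ p] by auto
    have "0 \<notin> set (tl rs)" using cons.prems(1) by (cases rs) auto
    with cons p have "partial_quotients b' c = rs" by auto
    moreover have "a = r * b' + c" "b = b'" using cons.prems p by auto
    ultimately show ?case using c by (simp add: partial_quotients_rec[of b'])
  qed
  then show "0 < a" "0 < b" "partial_quotients a b = rs" by simp_all
qed

lemma admissible_iff: "admissible rs \<longleftrightarrow> rs \<noteq> [] \<and> 0 \<notin> set (tl rs) \<and> 2 \<le> last rs"
proof (cases rs rule: rev_cases)
  case Nil
  then show ?thesis by (simp add: admissible_def)
next
  case (snoc us u)
  then show ?thesis
    by (auto simp: admissible_def zero_notin_set_tl_iff nth_append less_Suc_eq)
qed

lemma realizing_pair_iff: "realizing_pair rs p \<longleftrightarrow> admissible rs \<and> p = continuant_pair rs"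
proof
  assume "realizing_pair rs p"
  then show "admissible rs \<and> p = continuant_pair rs"
    using continuant_pair_partial_quotients[of "fst p" "snd p"] by (auto simp: realizing_pair_def)
next
  assume "admissible rs \<and> p = continuant_pair rs"
  then show "realizing_pair rs p"
    using partial_quotients_continuant_pair[of rs "fst p" "snd p"]
      coprime_continuant_pair[of rs "fst p" "snd p"]
    by (simp add: realizing_pair_def admissible_iff)
qed

lemma realizing_pair_ex1: "admissible rs \<Longrightarrow> \<exists>!p. realizing_pair rs p"
  by (simp add: realizing_pair_iff)

subsection \<open>Euclidean designs\<close>

definition quotient_word :: "nat list \<Rightarrow> nat list" where
  "quotient_word rs = block_word (butlast rs @ [last rs - 1]) @ [1]"

lemma quotient_word_odd:
  assumes "odd (length rs)" "0 < last rs"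
  shows "quotient_word rs = block_word rs"
proof -
  obtain us u where "rs = us @ [Suc u]"
    using assms by (cases rs rule: rev_cases) (auto simp: gr0_conv_Suc)
  with assms(1) show ?thesis by (simp add: quotient_word_def block_word_snoc_Suc)
qed

lemma euclidean_design_eq_quotient_word:
  assumes "0 < a" "0 < b"
  shows "euclidean_design a b = quotient_word (partial_quotients a b)"
proof (cases "(a, b) = (1, 1)")
  case True
  then show ?thesis
    by (simp add: euclidean_design_def quotient_word_def partial_quotients_rec block_word_Cons)
next
  case False
  then show ?thesis
    using quotient_word_odd[of "partial_quotients a b"] last_partial_quotients_pos[OF assms]
    by (auto simp: euclidean_design_def Let_def quotient_word_def)
qed

lemma word_action_replicate_1:
  "word_action (replicate k 1) (prod.swap p) = undo_division k p"
  by (induction k; cases p) auto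

lemma word_action_block_word_Cons:
  "word_action (block_word (k # ks)) p = undo_division k (word_action (block_word ks) (prod.swap p))"
proof -
  have "word_action (block_word (k # ks)) p
      = word_action (replicate k 1) (word_action (map (\<lambda>d. 1 - d) (block_word ks)) p)"
    by (simp only: block_word_Cons foldr_append comp_apply)
  also have "\<dots>
      = word_action (replicate k 1) (prod.swap (word_action (block_word ks) (prod.swap p)))"
    by (simp only: word_action_complement)
  finally show ?thesis
    by (simp only: word_action_replicate_1)
qed

lemma word_action_block_word:
  "word_action (block_word ks) (a, a) = foldr undo_division ks (a, a)"
  by (induction ks) (simp_all add: word_action_block_word_Cons)

lemma word_action_quotient_word:
  assumes "rs \<noteq> []" "0 < last rs"
  shows "word_action (quotient_word rs) (0, 1) = continuant_pair rs"
proof -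
  have "word_action (quotient_word rs) (0, 1)
      = foldr undo_division (butlast rs) (undo_division (last rs - 1) (1, 1))"
    by (simp add: quotient_word_def word_action_block_word)
  also have "\<dots> = foldr undo_division (butlast rs @ [last rs]) (1, 0)"
    using assms(2) by simp
  finally show ?thesis
    using assms(1) by (simp add: continuant_pair_def)
qed

lemma stern_euclidean_design:
  assumes "0 < a" "0 < b" "coprime a b" "binary_word_of m n (euclidean_design a b)"
  shows "a = stern n m" "b = stern n (2 ^ n - m)"
proof -
  have "(stern n m, stern n (2 ^ n - m)) = word_action (euclidean_design a b) (0, 1)"
    using word_action_eq_stern[OF assms(4), of 0 1] by simp
  also have "\<dots> = continuant_pair (partial_quotients a b)"
    using assms(1,2) last_partial_quotients_pos[OF assms(1,2)]
      word_action_quotient_word[of "partial_quotients a b"]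
    by (simp add: euclidean_design_eq_quotient_word)
  also have "\<dots> = (a, b)"
    using assms(3) by (rule continuant_pair_partial_quotients)
  finally show "a = stern n m" "b = stern n (2 ^ n - m)" by simp_all
qed

lemma euclidean_design_realizing_pair:
  "realizing_pair rs (a, b) \<Longrightarrow> euclidean_design a b = quotient_word rs"
  by (auto simp: realizing_pair_def euclidean_design_eq_quotient_word)

subsection \<open>Partial quotients from block lengths\<close>

lemma binary_word_of_snoc2_mod_4:
  assumes "binary_word_of m n (u @ [d, 1])"
  shows "m mod 4 = 2 * d + 1"
proof -
  obtain k where "n = Suc (Suc k)" using assms by (auto simp: binary_word_of_def)
  with assms have "binary_word_of m (Suc (Suc k)) ((u @ [d]) @ [1])" by simp
  then obtain m' where "d \<in> {0, 1}" "m = 2 * (2 * m' + d) + 1"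
    by (auto simp only: binary_word_of_snoc)
  then show ?thesis by auto
qed

lemma block_lengths_last_ge_2:
  assumes "block_lengths w ks" "2 \<le> last ks"
  shows "admissible ks" "quotient_word ks = w" "binary_word_of m n w \<Longrightarrow> m mod 4 = 3"
proof -
  show "admissible ks" "quotient_word ks = w"
    using assms by (auto simp: admissible_iff block_lengths_iff quotient_word_odd)
  obtain us l where ks: "ks = us @ [l]" "even (length us)"
    using assms(1) by (cases ks rule: rev_cases) (auto simp: block_lengths_iff)
  then obtain k where "l = Suc (Suc k)"
    using assms(2) by (auto simp: le_iff_add)
  with ks have "w = block_word (us @ [k]) @ [1, 1]"
    using assms(1) by (simp add: block_lengths_iff block_word_snoc_Suc)
  then show "m mod 4 = 3" if "binary_word_of m n w"
    using binary_word_of_snoc2_mod_4[of m n _ 1] that by simp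
qed

lemma block_lengths_last_eq_1:
  fixes ks :: "nat list"
  defines "rs \<equiv> take (length ks - 2) ks @ [ks ! (length ks - 2) + 1]"
  assumes "block_lengths w ks" "last ks = 1" "w \<noteq> [1]"
  shows "admissible rs" "quotient_word rs = w" "binary_word_of m n w \<Longrightarrow> m mod 4 = 1"
proof -
  have odd_ks: "odd (length ks)" and pos: "0 \<notin> set (tl ks)" and w: "w = block_word ks"
    using assms(2) by (auto simp: block_lengths_iff)
  obtain vs where vs: "ks = vs @ [1]"
    using odd_ks assms(3) by (cases ks rule: rev_cases) auto
  have "vs \<noteq> []" using vs w assms(4) by (auto simp: block_word_Cons)
  then obtain us l where ks: "ks = us @ [l, 1]"
    using vs by (cases vs rule: rev_cases) auto
  have odd_us: "odd (length us)" using odd_ks ks by simp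
  then obtain j where j: "l = Suc j" using pos ks by (cases us; cases l) auto
  have rs: "rs = us @ [Suc l]" by (simp add: rs_def ks)
  have w': "w = block_word (us @ [l]) @ [1]"
    using w ks odd_us block_word_snoc[of "us @ [l]" 1] by simp
  show "admissible rs"
    using pos ks rs j by (cases us) (auto simp: admissible_iff)
  show "quotient_word rs = w" by (simp add: quotient_word_def rs w')
  have "w = block_word (us @ [j]) @ [0, 1]"
    using w' odd_us by (simp add: j block_word_snoc_Suc)
  then show "m mod 4 = 1" if "binary_word_of m n w"
    using binary_word_of_snoc2_mod_4[of m n _ 0] that by simp
qed

lemma block_lengths_exists_if_odd:
  assumes "binary_word_of m n w" "odd m"
  shows "\<exists>ks. block_lengths w ks"
proof -
  have bits: "length w = n" "set w \<subseteq> {0, 1}"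
    using assms(1) by (auto simp: binary_word_of_def)
  have "w \<noteq> []" using assms by (auto simp: binary_word_of_def)
  then obtain u d k where w: "w = u @ [d]" and "n = Suc k"
    using bits(1) by (cases w rule: rev_cases) auto
  with assms have "d = 1" by (auto simp: binary_word_of_snoc)
  with w bits(2) show ?thesis by (intro block_lengths_exists) auto
qed

theorem theorem3p8:
  shows "(\<forall>a b m n :: nat.
            0 < a \<and> 0 < b \<and> coprime a b \<and> m \<le> 2 ^ n - 1 \<and> design m n = euclidean_design a b \<longrightarrow>
              a = stern n m \<and> b = stern n (2 ^ n - m) \<and>
              ((a, b) = (1, 1) \<longrightarrow> (m, n) = (1, 1)))
       \<and> (\<forall>m n :: nat.
            0 < n \<and> odd m \<and> 1 \<le> m \<and> m \<le> 2 ^ n - 1 \<and> (m, n) \<noteq> (1, 1) \<longrightarrow>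
              (\<exists>ks. block_lengths (design m n) ks) \<and>
              (\<forall>ks. block_lengths (design m n) ks \<longrightarrow>
                 (m mod 4 = 3 \<longleftrightarrow> 2 \<le> last ks) \<and>
                 (m mod 4 = 1 \<longleftrightarrow> last ks = 1) \<and>
                 (m mod 4 = 3 \<longrightarrow>
                    (\<exists>!p. realizing_pair ks p) \<and>
                    (\<forall>a b. realizing_pair ks (a, b) \<longrightarrow> design m n = euclidean_design a b)) \<and>
                 (m mod 4 = 1 \<longrightarrow>
                    (let l = length ks; rs = take (l - 2) ks @ [ks ! (l - 2) + 1] in
                       (\<exists>!p. realizing_pair rs p) \<and>
                       (\<forall>a b. realizing_pair rs (a, b) \<longrightarrow> design m n = euclidean_design a b)))))"
  (is "_ \<and> (\<forall>m n. _ m n \<longrightarrow> ?exists m n \<and> (\<forall>ks. ?blocks m n ks \<longrightarrow> ?quotients m n ks))")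
proof (rule conjI; intro allI impI; elim conjE)
  fix a b m n :: nat
  assume ab: "0 < a" "0 < b" "coprime a b"
    and "m \<le> 2 ^ n - 1" "design m n = euclidean_design a b"
  then have w: "binary_word_of m n (euclidean_design a b)"
    using binary_word_of_design_le by metis
  then show "a = stern n m \<and> b = stern n (2 ^ n - m) \<and> ((a, b) = (1, 1) \<longrightarrow> (m, n) = (1, 1))"
    using stern_euclidean_design[OF ab w] binary_word_of_singleton_1[of m n]
    by (auto simp: euclidean_design_def)
next
  fix m n :: nat
  assume m: "odd m" "m \<le> 2 ^ n - 1" "(m, n) \<noteq> (1, 1)"
  note w = binary_word_of_design_le[OF m(2)]
    and realizing = realizing_pair_ex1 euclidean_design_realizing_pair
  have nontrivial: "design m n \<noteq> []" "design m n \<noteq> [1]"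
    using w m binary_word_of_singleton_1[of m n] by (auto simp: binary_word_of_def)
  have "?quotients m n ks" if ks: "block_lengths (design m n) ks" for ks
  proof (cases "last ks = 1")
    case True
    from block_lengths_last_eq_1[OF ks this nontrivial(2)] w True realizing show ?thesis
      by (simp add: Let_def)
  next
    case False
    then have "2 \<le> last ks" using block_lengths_last_pos[OF ks nontrivial(1)] by linarith
    from block_lengths_last_ge_2[OF ks this] w this realizing show ?thesis by simp
  qed
  with block_lengths_exists_if_odd[OF w m(1)]
  show "?exists m n \<and> (\<forall>ks. ?blocks m n ks \<longrightarrow> ?quotients m n ks)" by blast
qed

end
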